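(* (a) There exists $\epsilon_0>0$ such that for all $0<\epsilon\le \epsilon_0$, all integers $K\ge 2$ and all integers $n\ge 1$, $$\sup_{\boldsymbol p_1\in\mathcal C,\dots,\boldsymbol p_n\in\mathcal C}\mathbb P\left(\left|\frac1n\sum_{i=1}^n\left(\sum_{k=1}^K z_{ik}\log p_{ik}-\sum_{k=1}^K p_{ik}\log p_{ik}\right)\right|\ge\epsilon\right)\le 2\exp\left(-\frac{n\epsilon^2}{4(\max\{\log K,\log 5\})^2}\right).$$ (b) Furthermore, let $K=K_n\ge 2$ depend on $n$. If $(\log K_n)^2/n=\Omega(1)$ as $n\to\infty$, then for all $\epsilon>0$, $$\sup_{\boldsymbol p_1\in\mathcal C,\dots,\boldsymbol p_n\in\mathcal C}\mathbb P\left(\left|\frac1n\sum_{i=1}^n\left(\sum_{k=1}^K z_{ik}\log p_{ik}-\sum_{k=1}^K p_{ik}\log p_{ik}\right)\right|\ge\epsilon\right)\not\to 0\quad\text{as } n\to\infty.$$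
   Context: $\mathcal C=\{\boldsymbol q=(q_1,\dots,q_K):0\le q_k\le1,\ k=1,\dots,K,\ \sum_{k=1}^K q_k=1\}$ (for $K=K_n$ in part (b)). Given $\boldsymbol p_i=(p_{i1},\dots,p_{iK})\in\mathcal C$, $i=1,\dots,n$, the random vectors $\boldsymbol z_i=(z_{i1},\dots,z_{iK})$, $i=1,\dots,n$, are independent, each $\boldsymbol z_i$ has exactly one entry equal to 1 and the others equal to 0, and $\mathbb P(z_{ik}=1)=p_{ik}$; the $\boldsymbol p_i$ may differ with $i$. The supremum is over all $(\boldsymbol p_1,\dots,\boldsymbol p_n)\in\mathcal C^n$, with $\mathbb P$ the law of $(\boldsymbol z_i)$ under these parameters. $\log$ is the natural logarithm, with the convention $0\log0=0$ (so $z_{ik}\log p_{ik}=0$ when $z_{ik}=p_{ik}=0$; the event $z_{ik}=1$ with $p_{ik}=0$ has probability zero). $a_n=\Omega(1)$ means there is a constant $c>0$ with $a_n\ge c$ for all sufficiently large $n$. *)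

theory Defs
  imports "HOL-Probability.Probability" "HOL-Library.Landau_Symbols"
begin

text \<open>
  Vectors of length \<open>K\<close> are functions on \<open>nat\<close> of which only the entries with index in
  \<open>{1..K}\<close> matter; families of \<open>n\<close> vectors are likewise indexed by \<open>{1..n}\<close>.
\<close>

definition prob_simplex :: "nat \<Rightarrow> (nat \<Rightarrow> real) set" where
  "prob_simplex K = {q. (\<forall>k\<in>{1..K}. 0 \<le> q k \<and> q k \<le> 1) \<and> (\<Sum>k=1..K. q k) = 1}"

definition unit_vec :: "nat \<Rightarrow> nat \<Rightarrow> real" where
  "unit_vec c = (\<lambda>k. if k = c then 1 else 0)"

text \<open>Meaningful only for \<open>q \<in> prob_simplex K\<close>, as the weights must sum to one.\<close>

definition categorical_pmf :: "nat \<Rightarrow> (nat \<Rightarrow> real) \<Rightarrow> nat pmf" where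
  "categorical_pmf K q = embed_pmf (\<lambda>k. if k \<in> {1..K} then q k else 0)"

definition one_hot_pmf :: "nat \<Rightarrow> (nat \<Rightarrow> real) \<Rightarrow> (nat \<Rightarrow> real) pmf" where
  "one_hot_pmf K q = map_pmf unit_vec (categorical_pmf K q)"

text \<open>
  The joint law of \<open>z\<^sub>1, \<dots>, z\<^sub>n\<close> as a product measure; the random vector \<open>z\<^sub>i\<close> is the coordinate
  map \<open>\<lambda>z. z i\<close>. The zero vector is a dummy value at the indices outside \<open>{1..n}\<close>.
\<close>

definition sample_law :: "nat \<Rightarrow> nat \<Rightarrow> (nat \<Rightarrow> nat \<Rightarrow> real) \<Rightarrow> (nat \<Rightarrow> nat \<Rightarrow> real) pmf" where
  "sample_law n K p = Pi_pmf {1..n} (\<lambda>_. 0) (\<lambda>i. one_hot_pmf K (p i))"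

text \<open>\<open>ln 0\<close> is a real number in HOL, so the convention \<open>0 log 0 = 0\<close> needs no case distinction.\<close>

definition mean_deviation ::
    "nat \<Rightarrow> nat \<Rightarrow> (nat \<Rightarrow> nat \<Rightarrow> real) \<Rightarrow> (nat \<Rightarrow> nat \<Rightarrow> real) \<Rightarrow> real" where
  "mean_deviation n K p z =
     1 / real n * (\<Sum>i=1..n. (\<Sum>k=1..K. z i k * ln (p i k)) - (\<Sum>k=1..K. p i k * ln (p i k)))"

definition sup_deviation_prob :: "nat \<Rightarrow> nat \<Rightarrow> real \<Rightarrow> real" where
  "sup_deviation_prob n K \<epsilon> =
     (SUP p \<in> {1..n} \<rightarrow> prob_simplex K.
        measure_pmf.prob (sample_law n K p) {z. \<bar>mean_deviation n K p z\<bar> \<ge> \<epsilon>})"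

text \<open>The supremum is a genuine one: it is taken over a nonempty set that is bounded above.\<close>

lemma param_space_nonempty:
  assumes "K \<ge> 1"
  shows "{1..n} \<rightarrow> prob_simplex K \<noteq> {}"
proof -
  have "(\<lambda>_. unit_vec 1) \<in> {1..n} \<rightarrow> prob_simplex K"
    using assms by (auto simp: prob_simplex_def unit_vec_def sum.delta)
  thus ?thesis by blast
qed

lemma deviation_prob_bdd_above:
  "bdd_above ((\<lambda>p. measure_pmf.prob (sample_law n K p) {z. \<bar>mean_deviation n K p z\<bar> \<ge> \<epsilon>}) ` A)"
  by (rule bdd_aboveI2[where M = 1]) simp

text \<open>The coordinate vectors of \<^const>\<open>sample_law\<close> have the properties required of the sample.\<close>

lemma pmf_categorical_pmf:
  assumes "q \<in> prob_simplex K"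
  shows "pmf (categorical_pmf K q) k = (if k \<in> {1..K} then q k else 0)"
  unfolding categorical_pmf_def
proof (rule pmf_embed_pmf)
  show "0 \<le> (if k \<in> {1..K} then q k else 0)" for k
    using assms by (auto simp: prob_simplex_def)
  have "(\<integral>\<^sup>+k. ennreal (if k \<in> {1..K} then q k else 0) \<partial>count_space UNIV)
      = (\<Sum>k=1..K. ennreal (if k \<in> {1..K} then q k else 0))"
    by (rule nn_integral_count_space') (auto split: if_splits)
  also have "\<dots> = (\<Sum>k=1..K. ennreal (q k))"
    by (rule sum.cong) auto
  also have "\<dots> = ennreal (\<Sum>k=1..K. q k)"
    using assms by (intro sum_ennreal) (auto simp: prob_simplex_def)
  also have "\<dots> = 1"
    using assms by (auto simp: prob_simplex_def)
  finally show "(\<integral>\<^sup>+k. ennreal (if k \<in> {1..K} then q k else 0) \<partial>count_space UNIV) = 1" .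
qed

lemma map_sample_law_coordinate:
  assumes "i \<in> {1..n}"
  shows "map_pmf (\<lambda>z. z i) (sample_law n K p) = one_hot_pmf K (p i)"
  using assms unfolding sample_law_def by (subst Pi_pmf_component) auto

lemma sample_law_one_hot:
  assumes "i \<in> {1..n}" and "p i \<in> prob_simplex K"
  shows "AE z in measure_pmf (sample_law n K p). \<exists>c\<in>{1..K}. z i = unit_vec c"
proof -
  have "set_pmf (one_hot_pmf K (p i)) \<subseteq> unit_vec ` {1..K}"
    using pmf_categorical_pmf[OF assms(2)]
    by (auto simp: one_hot_pmf_def set_pmf_iff split: if_splits)
  hence "(\<lambda>z. z i) ` set_pmf (sample_law n K p) \<subseteq> unit_vec ` {1..K}"
    using map_sample_law_coordinate[OF assms(1), of K p] by (metis set_map_pmf)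
  thus ?thesis by (auto simp: AE_measure_pmf_iff)
qed

lemma prob_sample_law_entry:
  assumes "i \<in> {1..n}" and "p i \<in> prob_simplex K" and "k \<in> {1..K}"
  shows "measure_pmf.prob (sample_law n K p) {z. z i k = 1} = p i k"
proof -
  have "measure_pmf.prob (sample_law n K p) {z. z i k = 1}
      = measure_pmf.prob (map_pmf (\<lambda>z. z i) (sample_law n K p)) {x. x k = 1}"
    by (simp add: vimage_def)
  also have "\<dots> = measure_pmf.prob (categorical_pmf K (p i)) {c. unit_vec c k = 1}"
    by (simp add: map_sample_law_coordinate[OF assms(1)] one_hot_pmf_def vimage_def)
  also have "{c. unit_vec c k = 1} = {k}"
    by (auto simp: unit_vec_def)
  finally show ?thesis
    using assms by (simp add: measure_pmf_single pmf_categorical_pmf)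
qed

lemma indep_sample_law:
  "prob_space.indep_vars (measure_pmf (sample_law n K p)) (\<lambda>_. count_space UNIV)
     (\<lambda>i z. z i) {1..n}"
  unfolding sample_law_def by (rule indep_vars_Pi_pmf) simp

end

theory Submission
  imports Defs
begin

text \<open>
  For (a), the second derivative at \<open>s\<close> of the cumulant generating function of \<open>ln p\<close> is
  \<open>1 / (1 + s)\<^sup>2\<close> times the variance of \<open>ln q\<close> under the tilted distribution \<open>q\<close>, hence at most
  \<open>1 / (1 + s)\<^sup>2\<close> times the maximum of \<open>\<Sum> q (ln q)\<^sup>2\<close> over all distributions. Jensen's inequality
  bounds this maximum by \<open>(ln (K + 2))\<^sup>2\<close>, which is less than \<open>2 L\<^sup>2\<close> for \<open>L = max (ln K) (ln 5)\<close>. The slack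
  absorbs the factor \<open>1 / (1 + s)\<^sup>2\<close> for small \<open>s\<close>, and Chernoff's bound with
  \<open>t = \<epsilon> / (2 L\<^sup>2)\<close> concludes.

  For (b), give mass \<open>1 / 2\<close> to one category and spread the rest evenly. Then \<open>ln p\<close> takes two
  values at distance \<open>ln (K - 1)\<close>, so the deviation of the sum is \<open>ln (K - 1) / 2\<close> times a simple
  random walk, of order \<open>sqrt n * ln (K - 1)\<close>, which is at least of order \<open>n\<close>. The Paley--Zygmund
  inequality applied to the exponential of the walk, rather than to the walk itself, shows that it
  exceeds any multiple of \<open>sqrt n\<close> with probability bounded away from zero.
\<close>

section \<open>Second moment of log-probabilities and the resulting sub-Gaussian bound\<close>

lemma ln_squared_concave: "concave_on {exp 1..} (\<lambda>x::real. (ln x)\<^sup>2)"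
proof (rule f''_le0_imp_concave)
  fix x :: real
  assume x: "x \<in> {exp 1..}"
  then have pos: "x > 0"
    by (auto intro: less_le_trans[OF exp_gt_zero])
  show "((\<lambda>x. (ln x)\<^sup>2) has_real_derivative 2 * ln x / x) (at x)"
    using pos by (auto intro!: derivative_eq_intros)
  show "((\<lambda>x. 2 * ln x / x) has_real_derivative 2 * (1 - ln x) / x\<^sup>2) (at x)"
    using pos by (auto intro!: derivative_eq_intros simp: field_simps power2_eq_square)
  have "ln x \<ge> 1"
    using x pos by (simp add: ln_ge_iff)
  then show "2 * (1 - ln x) / x\<^sup>2 \<le> 0"
    by (simp add: divide_le_0_iff)
qed simp

text \<open>
  The map \<open>x \<mapsto> (ln x)\<^sup>2\<close> is concave only for \<open>x \<ge> e\<close>, so Jensen's inequality is applied at the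
  shifted points \<open>1 / q a + 2 \<ge> 3\<close>.
\<close>

lemma sum_ln_squared_le:
  fixes q :: "'a \<Rightarrow> real"
  assumes fin: "finite A" and pos: "\<And>a. a \<in> A \<Longrightarrow> q a > 0" and sum1: "sum q A = 1"
  shows "(\<Sum>a\<in>A. q a * (ln (q a))\<^sup>2) \<le> (ln (real (card A) + 2))\<^sup>2"
proof -
  have ne: "A \<noteq> {}"
    using sum1 by auto
  have le1: "q a \<le> 1" if "a \<in> A" for a
    using member_le_sum[OF that, of q] fin pos sum1 by (force intro: less_imp_le)
  have inv: "1 / q a \<ge> 1" if "a \<in> A" for a
    using le1[OF that] pos[OF that] by (simp add: pos_le_divide_eq)
  have "(\<Sum>a\<in>A. q a * (ln (q a))\<^sup>2) \<le> (\<Sum>a\<in>A. q a * (ln (1 / q a + 2))\<^sup>2)"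
  proof (intro sum_mono mult_left_mono)
    fix a assume a: "a \<in> A"
    have "(ln (q a))\<^sup>2 = (ln (1 / q a))\<^sup>2"
      using pos[OF a] by (simp add: ln_div)
    also have "\<dots> \<le> (ln (1 / q a + 2))\<^sup>2"
      using inv[OF a] pos[OF a] by (intro power_mono ln_mono ln_ge_zero) auto
    finally show "(ln (q a))\<^sup>2 \<le> (ln (1 / q a + 2))\<^sup>2" .
  qed (use pos in \<open>auto intro: less_imp_le\<close>)
  also have "\<dots> \<le> (ln (\<Sum>a\<in>A. q a *\<^sub>R (1 / q a + 2)))\<^sup>2"
  proof -
    have "1 / q a + 2 \<in> {exp 1..}" if "a \<in> A" for a
      using inv[OF that] exp_le by auto
    then have "- (ln (\<Sum>a\<in>A. q a *\<^sub>R (1 / q a + 2)))\<^sup>2 \<le> (\<Sum>a\<in>A. q a * - (ln (1 / q a + 2))\<^sup>2)"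
      using ln_squared_concave fin ne sum1 pos
      by (intro convex_on_sum[where f = "\<lambda>x. - (ln x)\<^sup>2" and C = "{exp 1..}"])
         (auto simp: concave_on_def intro: less_imp_le)
    then show ?thesis
      by (simp add: sum_negf)
  qed
  also have "(\<Sum>a\<in>A. q a *\<^sub>R (1 / q a + 2)) = (\<Sum>a\<in>A. 1 + q a * 2)"
    by (intro sum.cong) (auto dest: pos simp: field_simps)
  also have "\<dots> = real (card A) + 2"
    by (simp add: sum.distrib sum1 flip: sum_distrib_right)
  finally show ?thesis .
qed

text \<open>Second-order Maclaurin expansion with Lagrange remainder, for \<open>t\<close> of either
  sign. Applied to \<open>- f\<close>, it turns a lower bound on the second derivative into a
  quadratic lower bound.\<close>

lemma taylor_quadratic_upper_bound:
  fixes f f' f'' :: "real \<Rightarrow> real"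
  assumes "\<And>x. \<bar>x\<bar> \<le> \<bar>t\<bar> \<Longrightarrow> (f has_real_derivative f' x) (at x)"
    and "\<And>x. \<bar>x\<bar> \<le> \<bar>t\<bar> \<Longrightarrow> (f' has_real_derivative f'' x) (at x)"
    and bound: "\<And>x. \<bar>x\<bar> \<le> \<bar>t\<bar> \<Longrightarrow> f'' x \<le> C"
  shows "f t \<le> f 0 + f' 0 * t + C / 2 * t\<^sup>2"
proof -
  define diff where "diff m = (if m = 0 then f else if m = 1 then f' else f'')" for m :: nat
  have "\<exists>s. \<bar>s\<bar> \<le> \<bar>t\<bar> \<and>
      f t = (\<Sum>m<2. diff m 0 / fact m * t ^ m) + diff 2 s / fact 2 * t ^ 2"
    using assms(1,2) by (intro Maclaurin_bi_le) (auto simp: diff_def less_2_cases_iff)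
  then obtain s where s: "\<bar>s\<bar> \<le> \<bar>t\<bar>" "f t = f 0 + f' 0 * t + f'' s / 2 * t\<^sup>2"
    by (auto simp: diff_def numeral_2_eq_2)
  then show ?thesis
    using bound[OF s(1)] by (auto intro!: mult_right_mono divide_right_mono)
qed

text \<open>
  The tilted distribution \<open>q\<close> is proportional to \<open>p powr (1 + s)\<close>, so that
  \<open>ln q = (1 + s) ln p - const\<close>.
\<close>

lemma entropy_mgf_le:
  fixes p :: "'a \<Rightarrow> real"
  assumes fin: "finite A" and pos: "\<And>a. a \<in> A \<Longrightarrow> p a > 0" and sum1: "sum p A = 1"
    and t: "\<bar>t\<bar> \<le> r" and r: "r < 1"
  defines "H \<equiv> \<Sum>a\<in>A. p a * ln (p a)"
  shows "(\<Sum>a\<in>A. p a * exp (t * (ln (p a) - H)))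
      \<le> exp ((ln (real (card A) + 2) / (1 - r))\<^sup>2 / 2 * t\<^sup>2)"
proof -
  have ne: "A \<noteq> {}"
    using sum1 by auto
  define l where "l a = ln (p a)" for a
  define w where "w s a = exp ((1 + s) * l a)" for s a
  define S where "S s = (\<Sum>a\<in>A. w s a)" for s
  define G where "G s = (\<Sum>a\<in>A. l a * w s a)" for s
  define V where "V s = (\<Sum>a\<in>A. (l a)\<^sup>2 * w s a)" for s
  have S_pos: "S s > 0" for s
    unfolding S_def w_def by (intro sum_pos fin ne) auto
  have dw: "((\<lambda>s. w s a) has_real_derivative l a * w s a) (at s)" for a s
    unfolding w_def by (auto intro!: derivative_eq_intros)
  have dS: "(S has_real_derivative G s) (at s)" for s
    unfolding S_def G_def by (intro DERIV_sum dw)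
  have dG: "(G has_real_derivative V s) (at s)" for s
    unfolding G_def V_def
    by (intro DERIV_sum DERIV_cong[OF DERIV_cmult[OF dw]]) (simp add: power2_eq_square)
  have w0: "w 0 a = p a" if "a \<in> A" for a
    using pos[OF that] by (simp add: w_def l_def)
  have S0: "S 0 = 1"
    unfolding S_def using w0 sum1 by simp
  have G0: "G 0 = H"
    unfolding G_def H_def by (intro sum.cong) (use w0 in \<open>auto simp: l_def\<close>)
  \<comment> \<open>The left-hand side is the variance of \<open>ln p\<close> under the tilted
    distribution \<open>w s / S s\<close>. Since \<open>G\<close> and \<open>V\<close> are the first
    two derivatives of \<open>S\<close>, it is also the second derivative of \<open>ln S\<close> at
    \<open>s\<close>.\<close>
  have second: "V s / S s - (G s / S s)\<^sup>2 \<le> (ln (real (card A) + 2) / (1 - r))\<^sup>2"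
    if s: "\<bar>s\<bar> \<le> \<bar>t\<bar>" for s
  proof -
    define q where "q a = w s a / S s" for a
    have ln_q: "ln (q a) = (1 + s) * l a - ln (S s)" for a
      using S_pos[of s] by (simp add: q_def w_def ln_div)
    have sum_q: "sum q A = 1"
      using S_pos[of s] by (simp add: q_def S_def flip: sum_divide_distrib)
    have "q a * (ln (q a))\<^sup>2 = (1 + s)\<^sup>2 * ((l a)\<^sup>2 * w s a) / S s
        - 2 * (1 + s) * ln (S s) * (l a * w s a) / S s + (ln (S s))\<^sup>2 * q a" for a
      unfolding ln_q using S_pos[of s] by (simp add: q_def field_simps power2_eq_square)
    then have "(\<Sum>a\<in>A. q a * (ln (q a))\<^sup>2) = (\<Sum>a\<in>A. (1 + s)\<^sup>2 * ((l a)\<^sup>2 * w s a) / S s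
        - 2 * (1 + s) * ln (S s) * (l a * w s a) / S s + (ln (S s))\<^sup>2 * q a)"
      by simp
    also have "\<dots> = (1 + s)\<^sup>2 * V s / S s - 2 * (1 + s) * ln (S s) * G s / S s + (ln (S s))\<^sup>2"
      unfolding sum.distrib sum_subtractf V_def G_def
      by (simp add: sum_q flip: sum_divide_distrib sum_distrib_left)
    \<comment> \<open>This splits the second moment of \<open>ln q\<close> into its variance,
      \<open>(1 + s)^2\<close> times that of \<open>l\<close>, and the square of its mean. Dropping
      the latter bounds the variance.\<close>
    also have "\<dots> = (1 + s)\<^sup>2 * (V s / S s - (G s / S s)\<^sup>2) + ((1 + s) * (G s / S s) - ln (S s))\<^sup>2"
      by (simp add: algebra_simps add_divide_distrib power2_eq_square)
    finally have "(1 + s)\<^sup>2 * (V s / S s - (G s / S s)\<^sup>2) \<le> (\<Sum>a\<in>A. q a * (ln (q a))\<^sup>2)"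
      by simp
    also have "\<dots> \<le> (ln (real (card A) + 2))\<^sup>2"
      using S_pos[of s] by (intro sum_ln_squared_le fin sum_q) (simp add: q_def w_def)
    finally have "V s / S s - (G s / S s)\<^sup>2 \<le> (ln (real (card A) + 2))\<^sup>2 / (1 + s)\<^sup>2"
      using s t r by (simp add: pos_le_divide_eq mult.commute)
    also have "\<dots> \<le> (ln (real (card A) + 2))\<^sup>2 / (1 - r)\<^sup>2"
      using s t r by (intro divide_left_mono power_mono mult_pos_pos zero_less_power) auto
    finally show ?thesis
      by (simp add: power_divide)
  qed
  \<comment> \<open>The centred cumulant generating function vanishes at 0 together with its
    derivative, as \<open>S 0 = 1\<close> and \<open>G 0 = H\<close>; only the quadratic term
    survives.\<close>
  have "ln (S t) - t * H \<le> (ln (S 0) - 0 * H) + (G 0 / S 0 - H) * t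
      + (ln (real (card A) + 2) / (1 - r))\<^sup>2 / 2 * t\<^sup>2"
  proof (rule taylor_quadratic_upper_bound[where f = "\<lambda>t. ln (S t) - t * H" and f' = "\<lambda>t. G t / S t - H"
        and f'' = "\<lambda>s. V s / S s - (G s / S s)\<^sup>2"])
    fix s
    show "((\<lambda>t. ln (S t) - t * H) has_real_derivative G s / S s - H) (at s)"
      using S_pos[of s] by (auto intro!: derivative_eq_intros dS)
    show "((\<lambda>t. G t / S t - H) has_real_derivative V s / S s - (G s / S s)\<^sup>2) (at s)"
      using S_pos[of s]
      by (auto intro!: derivative_eq_intros dS dG simp: field_simps power2_eq_square)
  qed (use second in auto)
  then have "ln (S t) - t * H \<le> (ln (real (card A) + 2) / (1 - r))\<^sup>2 / 2 * t\<^sup>2"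
    by (simp add: S0 G0)
  moreover have "(\<Sum>a\<in>A. p a * exp (t * (ln (p a) - H))) = (\<Sum>a\<in>A. w t a * exp (- t * H))"
  proof (intro sum.cong refl)
    fix a assume "a \<in> A"
    then have "p a = exp (l a)"
      using pos by (simp add: l_def)
    then show "p a * exp (t * (ln (p a) - H)) = w t a * exp (- t * H)"
      by (simp add: w_def algebra_simps flip: exp_add)
  qed
  then have "(\<Sum>a\<in>A. p a * exp (t * (ln (p a) - H))) = S t * exp (- t * H)"
    by (simp add: S_def sum_distrib_right)
  then have "(\<Sum>a\<in>A. p a * exp (t * (ln (p a) - H))) = exp (ln (S t) - t * H)"
    using S_pos[of t] by (simp add: exp_diff exp_minus divide_inverse)
  ultimately show ?thesis
    by simp
qed

section \<open>Finite supports and the moment generating function of the sum\<close>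

lemma set_categorical_pmf_subset:
  assumes "q \<in> prob_simplex K"
  shows "set_pmf (categorical_pmf K q) \<subseteq> {1..K}"
  using pmf_categorical_pmf[OF assms] by (auto simp: set_pmf_iff split: if_splits)

lemma finite_set_categorical_pmf:
  "q \<in> prob_simplex K \<Longrightarrow> finite (set_pmf (categorical_pmf K q))"
  using finite_subset[OF set_categorical_pmf_subset] by auto

lemma finite_set_sample_law:
  assumes "p \<in> {1..n} \<rightarrow> prob_simplex K"
  shows "finite (set_pmf (sample_law n K p))"
  unfolding sample_law_def one_hot_pmf_def using assms
  by (auto simp: set_Pi_pmf Pi_iff intro!: finite_PiE_dflt finite_imageI finite_set_categorical_pmf)

lemma expectation_one_hot:
  fixes f :: "(nat \<Rightarrow> real) \<Rightarrow> real"
  assumes "q \<in> prob_simplex K"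
  shows "measure_pmf.expectation (one_hot_pmf K q) f = (\<Sum>k=1..K. q k * f (unit_vec k))"
proof -
  have "measure_pmf.expectation (one_hot_pmf K q) f
      = (\<Sum>k=1..K. f (unit_vec k) * pmf (categorical_pmf K q) k)"
    unfolding one_hot_pmf_def using set_categorical_pmf_subset[OF assms]
    by (simp, intro integral_measure_pmf_real) auto
  also have "\<dots> = (\<Sum>k=1..K. q k * f (unit_vec k))"
    by (intro sum.cong) (auto simp: pmf_categorical_pmf[OF assms])
  finally show ?thesis .
qed

text \<open>Independence factorises the expectation, and at the unit vector with index
  \<open>k\<close> the inner sum collapses to \<open>ln (p i k)\<close>. Multiplying by
  \<open>real n\<close> undoes the averaging.\<close>

lemma expectation_exp_mean_deviation:
  assumes p: "p \<in> {1..n} \<rightarrow> prob_simplex K" and n: "n \<ge> 1"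
  shows "measure_pmf.expectation (sample_law n K p) (\<lambda>z. exp (t * (real n * mean_deviation n K p z)))
    = (\<Prod>i=1..n. \<Sum>k=1..K. p i k * exp (t * (ln (p i k) - (\<Sum>k=1..K. p i k * ln (p i k)))))"
proof -
  define f where
    "f i v = exp (t * ((\<Sum>k=1..K. v k * ln (p i k)) - (\<Sum>k=1..K. p i k * ln (p i k))))"
    for i and v :: "nat \<Rightarrow> real"
  have f_unit: "f i (unit_vec k) = exp (t * (ln (p i k) - (\<Sum>k=1..K. p i k * ln (p i k))))"
    if "k \<in> {1..K}" for i k
    using that by (simp add: f_def unit_vec_def if_distrib[of "\<lambda>x. x * _"] sum.delta cong: if_cong)
  have "exp (t * (real n * mean_deviation n K p z)) = (\<Prod>i=1..n. f i (z i))" for z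
    using n by (simp add: mean_deviation_def f_def sum_distrib_left flip: exp_sum)
  then have "measure_pmf.expectation (sample_law n K p)
        (\<lambda>z. exp (t * (real n * mean_deviation n K p z)))
      = measure_pmf.expectation (sample_law n K p) (\<lambda>z. \<Prod>i=1..n. f i (z i))"
    by simp
  also have "\<dots> = (\<Prod>i=1..n. measure_pmf.expectation (one_hot_pmf K (p i)) (f i))"
    unfolding sample_law_def
  proof (rule expectation_prod_Pi_pmf)
    fix i assume "i \<in> {1..n}"
    then show "integrable (measure_pmf (one_hot_pmf K (p i))) (f i)"
      unfolding one_hot_pmf_def using p
      by (intro integrable_measure_pmf_finite) (auto intro!: finite_set_categorical_pmf)
  qed (auto simp: f_def)
  also have "\<dots> = (\<Prod>i=1..n. \<Sum>k=1..K. p i k * f i (unit_vec k))"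
    using p by (intro prod.cong refl expectation_one_hot) auto
  also have "\<dots> = (\<Prod>i=1..n. \<Sum>k=1..K. p i k * exp (t * (ln (p i k) - (\<Sum>k=1..K. p i k * ln (p i k)))))"
    by (intro prod.cong sum.cong) (auto simp: f_unit)
  finally show ?thesis .
qed

section \<open>Tools for anti-concentration\<close>

text \<open>Integrates the pointwise inequality
  \<open>2 s Y - s m - s^2 Y^2 \<le> indicator B\<close>. On \<open>B\<close> it follows from
  \<open>(s Y - 1)^2 \<ge> 0\<close> and \<open>s m \<ge> 0\<close>, off \<open>B\<close> from
  \<open>2 Y \<le> m\<close>.\<close>

lemma paley_zygmund_pmf:
  fixes Y :: "'a \<Rightarrow> real"
  assumes fin: "finite (set_pmf M)"
    and m: "measure_pmf.expectation M Y \<ge> m" "m \<ge> 0"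
    and v: "measure_pmf.expectation M (\<lambda>x. (Y x)\<^sup>2) \<le> v" "v > 0"
  shows "m\<^sup>2 / (4 * v) \<le> measure_pmf.prob M {x. Y x \<ge> m / 2}"
proof (cases "m = 0")
  case False
  \<comment> \<open>This value maximises \<open>s m - s^2 v\<close>, the lower bound obtained after
    integration; the maximum is \<open>m^2 / (4 v)\<close>.\<close>
  define s where "s = m / (2 * v)"
  have s: "s > 0"
    using False m v by (simp add: s_def)
  note [simp] = integrable_measure_pmf_finite[OF fin]
  define B where "B = {x. Y x \<ge> m / 2}"
  have pw: "2 * s * Y x - s * m - s\<^sup>2 * (Y x)\<^sup>2 \<le> indicator B x" for x
  proof (cases "x \<in> B")
    case True
    have "0 \<le> (s * Y x - 1)\<^sup>2 + s * m"
      using s m by simp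
    then show ?thesis
      using True by (simp add: power2_eq_square algebra_simps)
  next
    case nB: False
    then have "2 * s * Y x \<le> s * m"
      using s by (simp add: B_def field_simps)
    moreover have "0 \<le> s\<^sup>2 * (Y x)\<^sup>2"
      by simp
    moreover have "indicat_real B x = 0"
      using nB by simp
    ultimately show ?thesis
      by linarith
  qed
  have "m\<^sup>2 / (4 * v) = 2 * s * m - s * m - s\<^sup>2 * v"
    using v by (simp add: s_def field_simps power2_eq_square)
  also have "\<dots> \<le> 2 * s * measure_pmf.expectation M Y - s * m
      - s\<^sup>2 * measure_pmf.expectation M (\<lambda>x. (Y x)\<^sup>2)"
    using s m v by (intro diff_mono mult_left_mono) auto
  also have "\<dots> = measure_pmf.expectation M (\<lambda>x. 2 * s * Y x - s * m - s\<^sup>2 * (Y x)\<^sup>2)"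
    by simp
  also have "\<dots> \<le> measure_pmf.expectation M (indicator B)"
    by (intro integral_mono pw) auto
  finally show ?thesis
    by (simp add: B_def)
qed auto

lemma exp_le_one_plus_double:
  fixes x :: real
  assumes "0 \<le> x" "x \<le> 1"
  shows "exp x \<le> 1 + 2 * x"
proof -
  have "x\<^sup>2 \<le> x"
    using assms by (simp add: power2_eq_square mult_left_le)
  with exp_bound[OF assms] show ?thesis
    by simp
qed

text \<open>On \<open>[-1, 1]\<close> the second derivative of \<open>cosh\<close>, again
  \<open>cosh\<close>, lies between 1 and 2. The two estimates serve to bound the first moment of
  the exponential of the walk from below and its second moment from above.\<close>

lemma cosh_bounds:
  fixes x :: real
  assumes "\<bar>x\<bar> \<le> 1"
  shows "exp (x\<^sup>2 / 4) \<le> cosh x" and "cosh x \<le> exp (x\<^sup>2)"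
proof -
  have sq: "x\<^sup>2 \<le> 1"
    using assms by (simp add: abs_square_le_1)
  have "- cosh x \<le> - cosh 0 + - sinh 0 * x + - 1 / 2 * x\<^sup>2"
    by (intro taylor_quadratic_upper_bound[where f'' = "\<lambda>x. - cosh x"])
       (auto intro!: derivative_eq_intros simp: cosh_real_ge_1)
  then have "1 + x\<^sup>2 / 2 \<le> cosh x"
    by simp
  moreover have "exp (x\<^sup>2 / 4) \<le> 1 + x\<^sup>2 / 2"
    using exp_le_one_plus_double[of "x\<^sup>2 / 4"] sq by simp
  ultimately show "exp (x\<^sup>2 / 4) \<le> cosh x"
    by simp
  have "cosh y \<le> 2" if "\<bar>y\<bar> \<le> \<bar>x\<bar>" for y
  proof -
    have "cosh y = cosh \<bar>y\<bar>"
      by (simp add: abs_if)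
    also have "\<dots> \<le> cosh 1"
      using that assms by (subst cosh_real_nonneg_le_iff) auto
    also have "\<dots> \<le> 2"
    proof -
      have "exp 1 + exp (- 1) \<le> (3 + 1 :: real)"
        by (intro add_mono exp_le) simp
      then show ?thesis
        by (simp add: cosh_field_def)
    qed
    finally show ?thesis .
  qed
  then have "cosh x \<le> cosh 0 + sinh 0 * x + 2 / 2 * x\<^sup>2"
    by (intro taylor_quadratic_upper_bound[where f'' = cosh]) (auto intro!: derivative_eq_intros)
  then show "cosh x \<le> exp (x\<^sup>2)"
    using exp_ge_add_one_self[of "x\<^sup>2"] unfolding cosh_0 sinh_0 by linarith
qed

section \<open>Chernoff bound for (a)\<close>

lemma ln_five_ge_one: "ln (5::real) \<ge> 1"
  using exp_le by (simp add: ln_ge_iff)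

text \<open>For \<open>x \<ge> 5\<close> one has \<open>x + 2 \<le> 7/5 x\<close> and
  \<open>(7/5)^4 = 2401/625 < 5 \<le> x\<close>, so \<open>(x + 2)^4 \<le> x^5\<close>.\<close>

lemma ln_add_two_le:
  fixes x :: real
  assumes "x \<ge> 5"
  shows "ln (x + 2) \<le> 5 / 4 * ln x"
proof -
  have "(x + 2) ^ 4 \<le> (7 / 5 * x) ^ 4"
    using assms by (intro power_mono) auto
  also have "\<dots> = 2401 / 625 * x ^ 4"
    by (simp add: power_mult_distrib power_divide)
  also have "\<dots> \<le> x * x ^ 4"
    using assms by (intro mult_right_mono) auto
  finally have "(x + 2) ^ 4 \<le> x ^ 5"
    by (simp add: eval_nat_numeral)
  then have "ln ((x + 2) ^ 4) \<le> ln (x ^ 5)"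
    using assms by (intro ln_mono) auto
  then have "4 * ln (x + 2) \<le> 5 * ln x"
    using assms by (simp add: ln_realpow)
  then show ?thesis
    by simp
qed

lemma categorical_mgf_le:
  assumes q: "q \<in> prob_simplex K" and t: "\<bar>t\<bar> \<le> 1 / 10"
  defines "L \<equiv> max (ln (real K)) (ln 5)"
  shows "(\<Sum>k=1..K. q k * exp (t * (ln (q k) - (\<Sum>k=1..K. q k * ln (q k))))) \<le> exp (L\<^sup>2 * t\<^sup>2)"
proof -
  \<comment> \<open>Categories of probability zero are removed because \<open>entropy_mgf_le\<close>
    requires positive weights; they contribute nothing to either sum.\<close>
  define A where "A = {k \<in> {1..K}. q k > 0}"
  have sub: "A \<subseteq> {1..K}" and fin: "finite A"
    by (auto simp: A_def)
  have zero: "q k = 0" if "k \<in> {1..K} - A" for k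
    using that q by (auto simp: A_def prob_simplex_def not_less intro: antisym)
  have restrict: "(\<Sum>k=1..K. q k * g k) = (\<Sum>k\<in>A. q k * g k)" for g
    using zero sub by (intro sum.mono_neutral_right) auto
  have sum1: "sum q A = 1"
    using q restrict[of "\<lambda>_. 1"] by (simp add: prob_simplex_def)
  define x where "x = max (real K) 5"
  have K: "real K > 0"
    using sum1 sub by (cases "K = 0") auto
  have L: "L = ln x"
    using K by (auto simp: L_def x_def max_def)
  have "real (card A) \<le> x"
    using card_mono[OF _ sub] by (simp add: x_def)
  then have "ln (real (card A) + 2) \<le> ln (x + 2)"
    by (intro ln_mono) auto
  also have "\<dots> \<le> 5 / 4 * L"
    unfolding L by (intro ln_add_two_le) (simp add: x_def)
  finally have card: "ln (real (card A) + 2) / (1 - 1 / 10) \<le> 25 / 18 * L"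
    by simp
  have "(ln (real (card A) + 2) / (1 - 1 / 10))\<^sup>2 \<le> (25 / 18 * L)\<^sup>2"
    by (intro power_mono card divide_nonneg_nonneg ln_ge_zero) auto
  \<comment> \<open>The factor 25/18 is 5/4 from \<open>ln_add_two_le\<close> times 10/9 from the
    tilt, and \<open>(25/18)^2 = 625/324 < 2\<close>.\<close>
  also have "\<dots> \<le> 2 * L\<^sup>2"
    by (simp add: power_mult_distrib power_divide)
  finally have half: "(ln (real (card A) + 2) / (1 - 1 / 10))\<^sup>2 / 2 \<le> L\<^sup>2"
    by simp
  have "(\<Sum>k\<in>A. q k * exp (t * (ln (q k) - (\<Sum>k\<in>A. q k * ln (q k)))))
      \<le> exp ((ln (real (card A) + 2) / (1 - 1 / 10))\<^sup>2 / 2 * t\<^sup>2)"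
    using t by (intro entropy_mgf_le fin sum1) (auto simp: A_def)
  also have "\<dots> \<le> exp (L\<^sup>2 * t\<^sup>2)"
    unfolding exp_le_cancel_iff by (intro mult_right_mono half) simp
  finally show ?thesis
    unfolding restrict .
qed

text \<open>Markov's inequality for \<open>exp (X x)\<close>: the indicator of
  \<open>X x \<ge> a\<close> is at most \<open>exp (X x - a)\<close>.\<close>

lemma prob_ge_le_expectation_exp:
  fixes X :: "'a \<Rightarrow> real"
  assumes fin: "finite (set_pmf M)"
  shows "measure_pmf.prob M {x. X x \<ge> a} \<le> exp (- a) * measure_pmf.expectation M (\<lambda>x. exp (X x))"
proof -
  have "measure_pmf.prob M {x. X x \<ge> a} = measure_pmf.expectation M (indicator {x. X x \<ge> a})"
    by simp
  also have "\<dots> \<le> measure_pmf.expectation M (\<lambda>x. exp (- a) * exp (X x))"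
    using integrable_measure_pmf_finite[OF fin]
    by (intro integral_mono) (auto simp: indicator_def simp flip: exp_add)
  finally show ?thesis
    by simp
qed

lemma prob_mean_deviation_le:
  assumes p: "p \<in> {1..n} \<rightarrow> prob_simplex K" and n: "n \<ge> 1" and e: "0 < \<epsilon>" "\<epsilon> \<le> 1 / 5"
  defines "L \<equiv> max (ln (real K)) (ln 5)"
  shows "measure_pmf.prob (sample_law n K p) {z. \<bar>mean_deviation n K p z\<bar> \<ge> \<epsilon>}
    \<le> 2 * exp (- (real n * \<epsilon>\<^sup>2 / (4 * L\<^sup>2)))"
proof -
  let ?M = "sample_law n K p"
  let ?X = "\<lambda>z. real n * mean_deviation n K p z"
  have L1: "L \<ge> 1"
    using ln_five_ge_one by (simp add: L_def)
  \<comment> \<open>The minimiser of \<open>L^2 t^2 - t \<epsilon>\<close>, with minimum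
    \<open>- \<epsilon>^2 / (4 L^2)\<close>.\<close>
  define t where "t = \<epsilon> / (2 * L\<^sup>2)"
  have t0: "t > 0"
    using e L1 by (simp add: t_def)
  have "1 \<le> L\<^sup>2"
    using L1 by simp
  \<comment> \<open>Here \<open>\<epsilon> \<le> 1/5\<close> and \<open>L \<ge> 1\<close> ensure
    \<open>t \<le> 1/10\<close>, the range of \<open>categorical_mgf_le\<close>.\<close>
  then have "5 * \<epsilon> \<le> L\<^sup>2"
    using e(2) by linarith
  then have "t \<le> 1 / 10"
    using L1 by (simp add: t_def divide_le_eq)
  then have t: "\<bar>u\<bar> \<le> 1 / 10" if "\<bar>u\<bar> = t" for u
    using that by simp
  \<comment> \<open>The choices \<open>u = t\<close> and \<open>u = - t\<close> give the upper and
    the lower tail.\<close>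
  have tail: "measure_pmf.prob ?M {z. u * ?X z \<ge> t * real n * \<epsilon>}
      \<le> exp (- (real n * \<epsilon>\<^sup>2 / (4 * L\<^sup>2)))" if u: "\<bar>u\<bar> = t" for u
  proof -
    have "measure_pmf.prob ?M {z. u * ?X z \<ge> t * real n * \<epsilon>}
        \<le> exp (- (t * real n * \<epsilon>)) * measure_pmf.expectation ?M (\<lambda>z. exp (u * ?X z))"
      by (intro prob_ge_le_expectation_exp finite_set_sample_law p)
    also have "measure_pmf.expectation ?M (\<lambda>z. exp (u * ?X z)) \<le> (\<Prod>i=1..n. exp (L\<^sup>2 * u\<^sup>2))"
      unfolding expectation_exp_mean_deviation[OF p n]
    proof (rule prod_mono)
      fix i assume "i \<in> {1..n}"
      then have "p i \<in> prob_simplex K"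
        using p by auto
      moreover from this have "0 \<le> p i k" if "k \<in> {1..K}" for k
        using that by (auto simp: prob_simplex_def)
      ultimately show "0 \<le> (\<Sum>k=1..K. p i k * exp (u * (ln (p i k) - (\<Sum>k=1..K. p i k * ln (p i k))))) \<and>
        (\<Sum>k=1..K. p i k * exp (u * (ln (p i k) - (\<Sum>k=1..K. p i k * ln (p i k))))) \<le> exp (L\<^sup>2 * u\<^sup>2)"
        unfolding L_def using categorical_mgf_le t[OF u] by (auto intro!: sum_nonneg)
    qed
    also have "u\<^sup>2 = t\<^sup>2"
      using u by (metis power2_abs)
    also have "exp (- (t * real n * \<epsilon>)) * (\<Prod>i=1..n. exp (L\<^sup>2 * t\<^sup>2))
        = exp (real n * (L\<^sup>2 * t\<^sup>2 - t * \<epsilon>))"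
      by (simp add: algebra_simps flip: exp_of_nat_mult exp_add)
    also have "real n * (L\<^sup>2 * t\<^sup>2 - t * \<epsilon>) = - (real n * \<epsilon>\<^sup>2 / (4 * L\<^sup>2))"
      using L1 by (simp add: t_def field_simps power2_eq_square)
    finally show ?thesis
      by simp
  qed
  have "{z. \<bar>mean_deviation n K p z\<bar> \<ge> \<epsilon>}
      \<subseteq> {z. t * ?X z \<ge> t * real n * \<epsilon>} \<union> {z. (- t) * ?X z \<ge> t * real n * \<epsilon>}"
  proof
    fix z assume "z \<in> {z. \<bar>mean_deviation n K p z\<bar> \<ge> \<epsilon>}"
    then have "\<epsilon> \<le> mean_deviation n K p z \<or> \<epsilon> \<le> - mean_deviation n K p z"
      by auto
    then have "t * real n * \<epsilon> \<le> t * real n * mean_deviation n K p z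
        \<or> t * real n * \<epsilon> \<le> t * real n * - mean_deviation n K p z"
      using mult_left_mono[of \<epsilon> _ "t * real n"] t0 by fastforce
    then show "z \<in> {z. t * ?X z \<ge> t * real n * \<epsilon>} \<union> {z. (- t) * ?X z \<ge> t * real n * \<epsilon>}"
      by (auto simp: mult.assoc)
  qed
  then have "measure_pmf.prob ?M {z. \<bar>mean_deviation n K p z\<bar> \<ge> \<epsilon>}
      \<le> measure_pmf.prob ?M ({z. t * ?X z \<ge> t * real n * \<epsilon>} \<union> {z. (- t) * ?X z \<ge> t * real n * \<epsilon>})"
    by (intro measure_pmf.finite_measure_mono) auto
  also have "\<dots> \<le> measure_pmf.prob ?M {z. t * ?X z \<ge> t * real n * \<epsilon>}
      + measure_pmf.prob ?M {z. (- t) * ?X z \<ge> t * real n * \<epsilon>}"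
    by (intro measure_Un_le) auto
  also have "\<dots> \<le> 2 * exp (- (real n * \<epsilon>\<^sup>2 / (4 * L\<^sup>2)))"
    using tail[of t] tail[of "- t"] t0 by simp
  finally show ?thesis .
qed

section \<open>The two-valued example and the lower bound for (b)\<close>

text \<open>
  Under this distribution \<open>ln q\<close> takes the two values \<open>- ln 2\<close> and \<open>- ln 2 - ln (K - 1)\<close>, each
  with probability \<open>1 / 2\<close>.
\<close>

definition half_spread :: "nat \<Rightarrow> nat \<Rightarrow> real" where
  "half_spread K k = (if k = 1 then 1 / 2 else 1 / (2 * (real K - 1)))"

text \<open>The \<open>K - 1\<close> light categories share mass \<open>1 / 2\<close> equally.
  Different choices of \<open>g\<close> yield the total mass, the negative entropy and the moment
  generating function.\<close>

lemma sum_half_spread: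
  assumes "K \<ge> 2"
  shows "(\<Sum>k=1..K. half_spread K k * g (half_spread K k))
    = g (1 / 2) / 2 + g (1 / (2 * (real K - 1))) / 2"
proof -
  have "(\<Sum>k=1..K. half_spread K k * g (half_spread K k)) = half_spread K 1 * g (half_spread K 1)
      + (\<Sum>k=2..K. half_spread K k * g (half_spread K k))"
    using assms by (subst sum.atLeast_Suc_atMost) (auto simp: numeral_2_eq_2)
  also have "(\<Sum>k=2..K. half_spread K k * g (half_spread K k))
      = (\<Sum>k=2..K. 1 / (2 * (real K - 1)) * g (1 / (2 * (real K - 1))))"
    by (intro sum.cong) (auto simp: half_spread_def)
  also have "\<dots> = g (1 / (2 * (real K - 1))) / 2"
    using assms by (simp add: of_nat_diff field_simps)
  finally show ?thesis
    by (simp add: half_spread_def)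
qed

lemma half_spread_in_prob_simplex:
  assumes "K \<ge> 2"
  shows "half_spread K \<in> prob_simplex K"
  using assms sum_half_spread[OF assms, of "\<lambda>_. 1"]
  by (auto simp: prob_simplex_def half_spread_def divide_le_eq)

text \<open>The centred \<open>ln\<close> of the probability is \<open>ln (K - 1) / 2\<close> times
  a fair random sign.\<close>

lemma half_spread_mgf:
  assumes K: "K \<ge> 2"
  shows "(\<Sum>k=1..K. half_spread K k *
      exp (t * (ln (half_spread K k) - (\<Sum>k=1..K. half_spread K k * ln (half_spread K k)))))
    = cosh (t * ln (real K - 1) / 2)"
proof -
  define a where "a = ln (real K - 1)"
  have "ln (2 * (real K - 1)) = ln 2 + a"
    unfolding a_def using K by (intro ln_mult_pos) auto
  moreover have "ln (1 / (2 * (real K - 1))) = - ln (2 * (real K - 1))"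
    using K by (subst ln_div) auto
  ultimately have l1: "ln (1 / (2 * (real K - 1))) = - ln 2 - a"
    by simp
  have l2: "ln (1 / 2) = - ln (2::real)"
    by (simp add: ln_div)
  have H: "(\<Sum>k=1..K. half_spread K k * ln (half_spread K k)) = - ln 2 - a / 2"
    unfolding sum_half_spread[OF K, of ln] l1 l2 by (simp add: field_simps)
  show ?thesis
    unfolding H sum_half_spread[OF K, of "\<lambda>x. exp (t * (ln x - (- ln 2 - a / 2)))"] l1 l2
    by (simp add: cosh_field_def a_def)
qed

text \<open>The bound depends on \<open>lam\<close> alone, hence is uniform in \<open>n\<close> and
  \<open>K\<close>. Here \<open>lam\<close> measures the deviation of the walk in units of
  \<open>sqrt n\<close>, and \<open>n \<ge> 4 lam^2\<close> keeps the arguments of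
  \<open>cosh\<close> in \<open>[-1, 1]\<close>.\<close>

lemma prob_half_spread_ge:
  assumes K: "K \<ge> 3" and n: "real n \<ge> 4 * lam\<^sup>2" and lam: "lam \<ge> 4"
    and e: "16 * \<epsilon> * sqrt (real n) \<le> lam * ln (real K - 1)"
  defines "p \<equiv> \<lambda>_. half_spread K"
  shows "exp (- 4 * lam\<^sup>2) / 4
    \<le> measure_pmf.prob (sample_law n K p) {z. \<bar>mean_deviation n K p z\<bar> \<ge> \<epsilon>}"
proof -
  let ?M = "sample_law n K p"
  define a where "a = ln (real K - 1)"
  have a: "a > 0"
    using K by (simp add: a_def)
  have p: "p \<in> {1..n} \<rightarrow> prob_simplex K"
    using K half_spread_in_prob_simplex[of K] by (simp add: p_def)
  have "4 * lam\<^sup>2 > 0"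
    using lam by simp
  then have n1: "n \<ge> 1"
    using n by (cases "n = 0") auto
  define r where "r = sqrt (real n)"
  have r: "r > 0" "r\<^sup>2 = real n"
    using n1 by (auto simp: r_def)
  have "(2 * lam)\<^sup>2 \<le> r\<^sup>2"
    using n r by (simp add: power_mult_distrib)
  then have lam_r: "2 * lam \<le> r"
    using r by (auto intro: power2_le_imp_le)
  \<comment> \<open>Chosen so that one step of the walk, scaled by \<open>t\<close>, has size
    \<open>t * a / 2 = lam / r\<close>; over \<open>n = r^2\<close> steps the moments of
    \<open>Y\<close> are then bounded in terms of \<open>lam\<close> only.\<close>
  define t where "t = 2 * lam / (a * r)"
  define Y where "Y z = exp (t * (real n * mean_deviation n K p z))" for z
  have mgf: "measure_pmf.expectation ?M (\<lambda>z. exp (u * (real n * mean_deviation n K p z)))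
      = cosh (u * a / 2) ^ n" for u
    unfolding expectation_exp_mean_deviation[OF p n1] unfolding p_def a_def
    using half_spread_mgf[of K u] K by simp
  have ta: "t * a / 2 = lam / r" "(2 * t) * a / 2 = 2 * lam / r"
    using a r by (simp_all add: t_def)
  have "exp (lam\<^sup>2 / 4) = exp ((lam / r)\<^sup>2 / 4) ^ n"
    using r n1 by (simp add: power_divide flip: exp_of_nat_mult)
  also have "\<dots> \<le> cosh (lam / r) ^ n"
    using lam lam_r r by (intro power_mono cosh_bounds) auto
  finally have m: "exp (lam\<^sup>2 / 4) \<le> measure_pmf.expectation ?M Y"
    unfolding Y_def mgf ta .
  have "cosh (2 * lam / r) ^ n \<le> exp ((2 * lam / r)\<^sup>2) ^ n"
    using lam lam_r r by (intro power_mono cosh_bounds) auto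
  also have "\<dots> = exp (4 * lam\<^sup>2)"
    using r n1 by (simp add: power_divide power_mult_distrib flip: exp_of_nat_mult)
  finally have "measure_pmf.expectation ?M (\<lambda>z. exp ((2 * t) * (real n * mean_deviation n K p z)))
      \<le> exp (4 * lam\<^sup>2)"
    unfolding mgf ta .
  moreover have "(\<lambda>z. exp ((2 * t) * (real n * mean_deviation n K p z))) = (\<lambda>z. (Y z)\<^sup>2)"
    by (simp add: Y_def fun_eq_iff mult.assoc flip: exp_double)
  ultimately have v: "measure_pmf.expectation ?M (\<lambda>z. (Y z)\<^sup>2) \<le> exp (4 * lam\<^sup>2)"
    by simp
  have "exp (- 4 * lam\<^sup>2) / 4 \<le> (exp (lam\<^sup>2 / 4))\<^sup>2 / (4 * exp (4 * lam\<^sup>2))"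
    by (simp add: exp_minus field_simps)
  also have "\<dots> \<le> measure_pmf.prob ?M {z. Y z \<ge> exp (lam\<^sup>2 / 4) / 2}"
    by (intro paley_zygmund_pmf finite_set_sample_law p m v) auto
  also have "\<dots> \<le> measure_pmf.prob ?M {z. \<bar>mean_deviation n K p z\<bar> \<ge> \<epsilon>}"
  proof (intro measure_pmf.finite_measure_mono subsetI CollectI)
    fix z assume "z \<in> {z. Y z \<ge> exp (lam\<^sup>2 / 4) / 2}"
    then have Yz: "exp (lam\<^sup>2 / 4) / 2 \<le> Y z"
      by simp
    \<comment> \<open>The condition \<open>lam \<ge> 4\<close> lets half of the exponent
      \<open>lam^2 / 4\<close> absorb the factor \<open>1 / 2\<close> in the Paley-Zygmund
      event.\<close>
    have "16 \<le> lam\<^sup>2"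
      using power_mono[OF lam, of 2] by simp
    then have "2 \<le> exp (lam\<^sup>2 / 8)"
      using exp_ge_add_one_self[of "lam\<^sup>2 / 8"] by linarith
    then have "exp (lam\<^sup>2 / 8) * 2 \<le> exp (lam\<^sup>2 / 8) * exp (lam\<^sup>2 / 8)"
      by (intro mult_left_mono) auto
    then have "exp (lam\<^sup>2 / 8) \<le> exp (lam\<^sup>2 / 4) / 2"
      by (simp flip: exp_add)
    also note Yz
    finally have "lam\<^sup>2 / 8 \<le> t * (real n * mean_deviation n K p z)"
      by (simp add: Y_def)
    also have "\<dots> = lam * (2 * r * mean_deviation n K p z / a)"
      using a r by (simp add: t_def r(2)[symmetric] power2_eq_square)
    finally have "lam * (lam / 8) \<le> lam * (2 * r * mean_deviation n K p z / a)"
      by (simp add: power2_eq_square)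
    then have "lam / 8 \<le> 2 * r * mean_deviation n K p z / a"
      using lam by (simp only: mult_le_cancel_left_pos)
    then have "lam * a \<le> 16 * r * mean_deviation n K p z"
      using a by (simp add: field_simps)
    then have "r * \<epsilon> \<le> r * mean_deviation n K p z"
      using e by (simp add: r_def a_def mult_ac)
    then show "\<epsilon> \<le> \<bar>mean_deviation n K p z\<bar>"
      using r by simp
  qed simp
  finally show ?thesis .
qed

theorem theorem1:
  shows "(\<exists>\<epsilon>\<^sub>0::real. \<epsilon>\<^sub>0 > 0 \<and>
            (\<forall>\<epsilon>::real. 0 < \<epsilon> \<and> \<epsilon> \<le> \<epsilon>\<^sub>0 \<longrightarrow>
              (\<forall>K::nat. K \<ge> 2 \<longrightarrow> (\<forall>n::nat. n \<ge> 1 \<longrightarrow>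
                 sup_deviation_prob n K \<epsilon>
                   \<le> 2 * exp (- (real n * \<epsilon>\<^sup>2 / (4 * (max (ln (real K)) (ln 5))\<^sup>2)))))))
         \<and>
         (\<forall>K :: nat \<Rightarrow> nat. (\<forall>n\<ge>1. K n \<ge> 2) \<and>
              (\<lambda>n. (ln (real (K n)))\<^sup>2 / real n) \<in> \<Omega>(\<lambda>_. 1) \<longrightarrow>
            (\<forall>\<epsilon>::real. \<epsilon> > 0 \<longrightarrow>
              \<not> ((\<lambda>n. sup_deviation_prob n (K n) \<epsilon>) \<longlonglongrightarrow> 0)))"
proof (rule conjI)
  show "\<exists>\<epsilon>\<^sub>0::real. \<epsilon>\<^sub>0 > 0 \<and>
            (\<forall>\<epsilon>::real. 0 < \<epsilon> \<and> \<epsilon> \<le> \<epsilon>\<^sub>0 \<longrightarrow>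
              (\<forall>K::nat. K \<ge> 2 \<longrightarrow> (\<forall>n::nat. n \<ge> 1 \<longrightarrow>
                 sup_deviation_prob n K \<epsilon>
                   \<le> 2 * exp (- (real n * \<epsilon>\<^sup>2 / (4 * (max (ln (real K)) (ln 5))\<^sup>2))))))"
  proof (intro exI[of _ "1 / 5"] conjI allI impI)
    fix \<epsilon> :: real and K n :: nat
    assume "0 < \<epsilon> \<and> \<epsilon> \<le> 1 / 5" "K \<ge> 2" "n \<ge> 1"
    then show "sup_deviation_prob n K \<epsilon>
        \<le> 2 * exp (- (real n * \<epsilon>\<^sup>2 / (4 * (max (ln (real K)) (ln 5))\<^sup>2)))"
      unfolding sup_deviation_prob_def
      by (intro cSUP_least param_space_nonempty prob_mean_deviation_le) auto
  qed simp
next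
  show "\<forall>K :: nat \<Rightarrow> nat. (\<forall>n\<ge>1. K n \<ge> 2) \<and>
              (\<lambda>n. (ln (real (K n)))\<^sup>2 / real n) \<in> \<Omega>(\<lambda>_. 1) \<longrightarrow>
            (\<forall>\<epsilon>::real. \<epsilon> > 0 \<longrightarrow>
              \<not> ((\<lambda>n. sup_deviation_prob n (K n) \<epsilon>) \<longlonglongrightarrow> 0))"
  proof (intro allI impI notI)
    fix K :: "nat \<Rightarrow> nat" and \<epsilon> :: real
    assume K: "(\<forall>n\<ge>1. K n \<ge> 2) \<and> (\<lambda>n. (ln (real (K n)))\<^sup>2 / real n) \<in> \<Omega>(\<lambda>_. 1)"
      and e: "\<epsilon> > 0" and lim: "(\<lambda>n. sup_deviation_prob n (K n) \<epsilon>) \<longlonglongrightarrow> 0"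
    from K obtain c where c: "c > 0"
      and growth: "\<forall>\<^sub>F n in sequentially. norm ((ln (real (K n)))\<^sup>2 / real n) \<ge> c * norm (1::real)"
      using landau_omega.bigE by blast
    \<comment> \<open>Since eventually
      \<open>ln (K n - 1) \<ge> ln (K n) / 2 \<ge> sqrt (c n) / 2\<close>, the requirement
      \<open>16 \<epsilon> sqrt n \<le> lam * ln (K n - 1)\<close> holds once
      \<open>lam \<ge> 32 \<epsilon> / sqrt c\<close>.\<close>
    define lam where "lam = max 4 (32 * \<epsilon> / sqrt c)"
    \<comment> \<open>The threshold \<open>1 / c\<close> forces \<open>ln (K n) \<ge> 1\<close>,
      which excludes \<open>K n = 2\<close>, where \<open>ln (K n - 1)\<close> vanishes.\<close>
    have "\<forall>\<^sub>F n in sequentially. real n \<ge> max (4 * lam\<^sup>2) (1 / c)"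
      using filterlim_real_sequentially unfolding filterlim_at_top by blast
    then have "\<forall>\<^sub>F n in sequentially. exp (- 4 * lam\<^sup>2) / 4 \<le> sup_deviation_prob n (K n) \<epsilon>"
      using growth eventually_ge_at_top[of 1]
    proof eventually_elim
      case (elim n)
      have n0: "real n > 0" and n: "real n \<ge> 4 * lam\<^sup>2" and K2: "K n \<ge> 2"
        using elim K by auto
      have ln0: "ln (real (K n)) \<ge> 0"
        using K2 by simp
      have cn: "c * real n \<le> (ln (real (K n)))\<^sup>2"
        using elim n0 by (simp add: pos_le_divide_eq)
      then have root: "sqrt c * sqrt (real n) \<le> ln (real (K n))"
        using ln0 by (metis real_le_lsqrt real_sqrt_le_mono real_sqrt_mult real_sqrt_unique)
      have "1 \<le> c * real n"
        using elim c by (simp add: divide_le_eq mult.commute)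
      then have "1 \<le> (ln (real (K n)))\<^sup>2"
        using cn by simp
      then have "1 \<le> ln (real (K n))"
        using ln0 power2_le_imp_le[of 1 "ln (real (K n))"] by simp
      moreover have "ln 2 < (1::real)"
        by (rule ln_2_less_1)
      ultimately have K3: "K n \<ge> 3"
        using K2 by (cases "K n = 2") auto
      \<comment> \<open>For \<open>K n \<ge> 3\<close> this costs only a factor 2 in passing from
        \<open>ln (K n)\<close> to \<open>ln (K n - 1)\<close>.\<close>
      have "real (K n) \<le> (real (K n) - 1)\<^sup>2"
      proof -
        have "0 \<le> real (K n) * (real (K n) - 3)"
          using K3 by simp
        then show ?thesis
          by (simp add: power2_eq_square algebra_simps)
      qed
      then have "ln (real (K n)) \<le> ln ((real (K n) - 1)\<^sup>2)"
        using K3 by (intro ln_mono) auto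
      then have half: "ln (real (K n)) \<le> 2 * ln (real (K n) - 1)"
        using K3 by (simp add: ln_realpow)
      have "32 * \<epsilon> / sqrt c \<le> lam"
        by (simp add: lam_def)
      then have "32 * \<epsilon> \<le> lam * sqrt c"
        using c by (simp add: pos_divide_le_eq)
      then have "32 * \<epsilon> * sqrt (real n) \<le> lam * sqrt c * sqrt (real n)"
        by (intro mult_right_mono) auto
      also have "\<dots> \<le> lam * (2 * ln (real (K n) - 1))"
        unfolding mult.assoc by (intro mult_left_mono order_trans[OF root half]) (simp add: lam_def)
      finally have "16 * \<epsilon> * sqrt (real n) \<le> lam * ln (real (K n) - 1)"
        by simp
      then have "exp (- 4 * lam\<^sup>2) / 4 \<le> measure_pmf.prob (sample_law n (K n) (\<lambda>_. half_spread (K n)))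
          {z. \<bar>mean_deviation n (K n) (\<lambda>_. half_spread (K n)) z\<bar> \<ge> \<epsilon>}"
        by (intro prob_half_spread_ge K3 n) (simp_all add: lam_def)
      also have "\<dots> \<le> sup_deviation_prob n (K n) \<epsilon>"
        unfolding sup_deviation_prob_def
        using half_spread_in_prob_simplex[OF K2]
        by (intro cSUP_upper deviation_prob_bdd_above) auto
      finally show ?case .
    qed
    then have "exp (- 4 * lam\<^sup>2) / 4 \<le> 0"
      by (intro tendsto_lowerbound[OF lim]) simp_all
    then show False
      using exp_gt_zero[of "- 4 * lam\<^sup>2"] by simp
  qed
qed

end
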